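(* Let $d>0$ be an integer, let $n=p_1p_2\cdots p_r$ with not necessarily distinct prime factors $p_1,\ldots,p_r\ge \frac{7}{2}d-3$, and let $k=a_1a_2\cdots a_r$ be a product of positive integers $a_1,a_2,\ldots,a_r\ge d$. Then $$s_{kn}(C_n^d)\le 9kn.$$ If furthermore each $p_i$ satisfies $p_i\ge 4d-2$ and each $a_i$ satisfies $a_i\ge p_i+d$, then $$s_{kn}(C_n^d)\le 3kn.$$
   Context: $C_n$ is the cyclic group of order $n$ and $C_n^d$ is the direct sum of $d$ copies of it. A sequence over a finite abelian group $G$ (written additively) is a finite sequence of elements of $G$, repetitions allowed, order irrelevant (a finite multiset); its length is the number of terms counted with multiplicity; a subsequence is a sub-multiset; a sequence is zero-sum if the sum of its terms is $0$. For a positive integer $m$, $s_m(G)$ is the smallest positive integer $\ell$ such that every sequence over $G$ of length at least $\ell$ has a zero-sum subsequence of length exactly $m$ ($s_m(G)=\infty$ if no such $\ell$ exists). *)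

theory Defs
  imports
    "HOL-Algebra.Product_Groups"
    "HOL-Algebra.FiniteProduct"
    "HOL-Computational_Algebra.Primes"
    "HOL-Library.Multiset"
    "HOL-Library.Extended_Nat"
    Complex_Main
begin

text \<open>
  Finite abelian groups are the multiplicatively written groups of HOL-Algebra, so the sum of a
  sequence is rendered by the product operation of the group and a zero-sum sequence is one
  whose product is the unit.
\<close>

text \<open>
  The direct sum of \<^term>\<open>d\<close> copies of the cyclic group of order \<^term>\<open>n\<close>; direct sum and direct
  product agree for a finite index set. For \<^term>\<open>n = 0\<close> the library's
  \<^const>\<open>integer_mod_group\<close> is the infinite cyclic group.
\<close>

definition cyclic_power :: "nat \<Rightarrow> nat \<Rightarrow> (nat \<Rightarrow> int) monoid" where
  "cyclic_power n d = product_group {..<d} (\<lambda>_. integer_mod_group n)"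

definition seq_over :: "('a, 'b) monoid_scheme \<Rightarrow> 'a multiset \<Rightarrow> bool" where
  "seq_over G S \<longleftrightarrow> set_mset S \<subseteq> carrier G"

text \<open>The terms are grouped by their values, each value being taken with its multiplicity.\<close>

definition seq_sum :: "('a, 'b) monoid_scheme \<Rightarrow> 'a multiset \<Rightarrow> 'a" where
  "seq_sum G S = (\<Otimes>\<^bsub>G\<^esub> x\<in>set_mset S. x [^]\<^bsub>G\<^esub> count S x)"

definition zero_sum :: "('a, 'b) monoid_scheme \<Rightarrow> 'a multiset \<Rightarrow> bool" where
  "zero_sum G S \<longleftrightarrow> seq_sum G S = \<one>\<^bsub>G\<^esub>"

text \<open>The infimum of the empty set is \<^term>\<open>\<infinity> :: enat\<close>; a nonempty infimum is a minimum.\<close>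

definition s_const :: "nat \<Rightarrow> ('a, 'b) monoid_scheme \<Rightarrow> enat" where
  "s_const m G = Inf {enat l | l. 0 < l \<and>
     (\<forall>S. seq_over G S \<and> l \<le> size S \<longrightarrow> (\<exists>T. T \<subseteq># S \<and> size T = m \<and> zero_sum G T))}"

lemma comm_group_cyclic_power: "comm_group (cyclic_power n d)"
proof (rule group.group_comm_groupI)
  show "group (cyclic_power n d)"
    by (simp add: cyclic_power_def)
qed (simp add: cyclic_power_def add.commute)

lemma order_cyclic_power: "0 < n \<Longrightarrow> order (cyclic_power n d) = n ^ d"
  by (simp add: order_def cyclic_power_def carrier_integer_mod_group card_PiE)

lemma seq_sum_empty: "comm_group G \<Longrightarrow> seq_sum G {#} = \<one>\<^bsub>G\<^esub>"
  by (simp add: seq_sum_def comm_group.axioms(1) comm_monoid.finprod_empty)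

lemma seq_sum_add_mset:
  fixes G (structure)
  assumes "comm_group G" "x \<in> carrier G" "seq_over G S"
  shows "seq_sum G (add_mset x S) = x \<otimes>\<^bsub>G\<^esub> seq_sum G S"
proof -
  interpret comm_group G by fact
  define R where "R = set_mset S - {x}"
  have R: "R \<subseteq> carrier G" "finite R" "x \<notin> R" "set_mset (add_mset x S) = insert x R"
    using assms(3) by (auto simp: R_def seq_over_def)
  have pw: "(\<lambda>y. y [^] count M y) \<in> R \<rightarrow> carrier G" for M
    using R(1) by auto
  have eq: "(\<Otimes>y\<in>R. y [^] count (add_mset x S) y) = (\<Otimes>y\<in>R. y [^] count S y)"
    using R by (intro finprod_cong') auto
  have 1: "seq_sum G (add_mset x S) = x [^] Suc (count S x) \<otimes> (\<Otimes>y\<in>R. y [^] count S y)"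
    unfolding seq_sum_def R(4) using R pw assms(2) eq
    by (subst finprod_insert) auto
  have 2: "seq_sum G S = x [^] count S x \<otimes> (\<Otimes>y\<in>R. y [^] count S y)"
  proof (cases "x \<in># S")
    case True
    then have "set_mset S = insert x R" by (auto simp: R_def)
    then show ?thesis unfolding seq_sum_def using R pw assms(2)
      by (simp add: finprod_insert)
  next
    case False
    then have "set_mset S = R" "count S x = 0" by (auto simp: R_def not_in_iff)
    then show ?thesis unfolding seq_sum_def using pw by simp
  qed
  have "(\<Otimes>y\<in>R. y [^] count S y) \<in> carrier G"
    using pw by (rule finprod_closed)
  then show ?thesis
    unfolding 1 2 using assms(2) by (simp add: m_ac)
qed

end

theory Submission
  imports Defs "HOL-Number_Theory.Residues" "HOL-Library.Disjoint_Sets"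
begin

text \<open>
  For a prime \<open>p\<close> let \<open>L(S)\<close> be the set of all \<open>w\<close> such that \<open>S\<close> has a zero-sum subsequence
  of length \<open>w p\<close>. The polynomial method, applied to multilinear polynomials modulo \<open>p\<close> in the
  indicator variables of the terms, with \<open>binomial(|I|, p)\<close> detecting \<open>|I| / p\<close> modulo \<open>p\<close>,
  shows that \<open>L(S)\<close> misses at most \<open>d - 1\<close> elements of \<open>{1..M}\<close> once
  \<open>|S| \<ge> (M + 1) p - d\<close> and \<open>M < p\<close>.

  Let \<open>p \<ge> 3 d - 1\<close>, \<open>k \<ge> d\<close> and \<open>|S| \<ge> (k + 5 d - 3) p\<close>, and suppose \<open>k\<close> is not in \<open>L(S)\<close>. By
  induction on \<open>k\<close>, no \<open>u\<close> with \<open>1 \<le> u \<le> k - d\<close> lies in \<open>L(S)\<close>, since otherwise removing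
  such a subsequence would leave one of length \<open>(k - u) p\<close>. Counting missing elements,
  \<open>L(S)\<close> contains some \<open>w\<close> with \<open>k + d \<le> w \<le> 3 d - 2\<close>, and there are two disjoint zero-sum
  subsequences \<open>W\<close> with lengths of this kind. Complementation inside \<open>W\<close> makes \<open>L(W)\<close> symmetric
  under \<open>u \<mapsto> w - u\<close>, so fewer than half of the numbers below \<open>k\<close> are missing from each \<open>L(W)\<close>;
  hence some \<open>u\<close> and \<open>k - u\<close> occur in the two of them, and \<open>k\<close> is in \<open>L(S)\<close> after all.

  For composite \<open>n\<close>, split off disjoint subsequences that vanish modulo one prime factor, divide
  their sums by that prime and iterate.
\<close>

section \<open>Multilinear polynomials on subsets\<close>

text \<open>
  A function on finite sets stands for a function on 0/1-vectors; \<open>J \<subseteq> I\<close> is the monomial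
  \<open>\<Prod>j\<in>J. x\<^sub>j\<close>.
\<close>

inductive bounded_degree :: "nat \<Rightarrow> ('a set \<Rightarrow> int) \<Rightarrow> bool" for D where
  monom: "finite J \<Longrightarrow> card J \<le> D \<Longrightarrow> bounded_degree D (\<lambda>I. c * of_bool (J \<subseteq> I))"
| add: "bounded_degree D F \<Longrightarrow> bounded_degree D G \<Longrightarrow> bounded_degree D (\<lambda>I. F I + G I)"

lemma bounded_degree_const: "bounded_degree D (\<lambda>_. c)"
  using monom[of "{}" D c] by simp

lemma bounded_degree_sum:
  "finite A \<Longrightarrow> (\<And>x. x \<in> A \<Longrightarrow> bounded_degree D (F x)) \<Longrightarrow> bounded_degree D (\<lambda>I. \<Sum>x\<in>A. F x I)"
  by (induction A rule: finite_induct) (auto intro: bounded_degree_const bounded_degree.add)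

text \<open>Variables are idempotent on 0/1-vectors, so the monomials of \<open>K\<close> and
  \<open>J\<close> multiply to that of \<open>K \<union> J\<close>, and degrees add at most.\<close>

lemma bounded_degree_mult_monom:
  assumes "bounded_degree D F" "finite J" "card J \<le> E"
  shows "bounded_degree (D + E) (\<lambda>I. F I * (c * of_bool (J \<subseteq> I)))"
  using assms(1)
proof induction
  case (monom K b)
  have "card (K \<union> J) \<le> D + E"
    using card_Un_le[of K J] monom(2) assms(3) by simp
  then have "bounded_degree (D + E) (\<lambda>I. (b * c) * of_bool (K \<union> J \<subseteq> I))"
    using monom(1) assms(2) by (intro bounded_degree.monom) auto
  then show ?case
    by (simp add: of_bool_conj mult_ac)
next
  case (add F G)
  then show ?case
    using bounded_degree.add by (fastforce simp: distrib_right)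
qed

lemma bounded_degree_mult:
  assumes "bounded_degree E G" "bounded_degree D F"
  shows "bounded_degree (D + E) (\<lambda>I. F I * G I)"
  using assms(1)
proof induction
  case (monom J c)
  then show ?case using bounded_degree_mult_monom assms(2) by blast
next
  case (add F G)
  then show ?case
    using bounded_degree.add by (fastforce simp: distrib_left)
qed

lemma bounded_degree_prod:
  "finite A \<Longrightarrow> (\<And>x. x \<in> A \<Longrightarrow> bounded_degree D (F x)) \<Longrightarrow>
    bounded_degree (card A * D) (\<lambda>I. \<Prod>x\<in>A. F x I)"
proof (induction A rule: finite_induct)
  case empty
  then show ?case by (simp add: bounded_degree_const)
next
  case (insert x A)
  then show ?case
    using bounded_degree_mult[of "card A * D" "\<lambda>I. \<Prod>x\<in>A. F x I" D "F x"] by simp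
qed

lemma bounded_degree_power:
  "bounded_degree D F \<Longrightarrow> bounded_degree (e * D) (\<lambda>I. F I ^ e)"
  using bounded_degree_prod[of "{..<e}" D "\<lambda>_. F"] by simp

lemma bounded_degree_diff_const:
  assumes "bounded_degree D F"
  shows "bounded_degree D (\<lambda>I. c - F I)"
proof -
  have "bounded_degree (D + 0) (\<lambda>I. F I * (- 1))"
    by (rule bounded_degree_mult[OF bounded_degree_const assms])
  then show ?thesis
    using bounded_degree.add[OF bounded_degree_const[of D c]] by fastforce
qed

lemma sum_Pow_insert:
  fixes g :: "'a set \<Rightarrow> 'b::comm_monoid_add"
  assumes "finite U" "x \<notin> U"
  shows "(\<Sum>I\<in>Pow (insert x U). g I) = (\<Sum>I\<in>Pow U. g I + g (insert x I))"
proof -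
  have "inj_on (insert x) (Pow U)"
    using assms(2) by (auto simp: inj_on_def)
  then show ?thesis
    unfolding Pow_insert using assms
    by (subst sum.union_disjoint) (auto simp: sum.reindex sum.distrib)
qed

text \<open>A monomial in fewer than \<open>card U\<close> variables misses some
  \<open>x \<in> U\<close>. Toggling \<open>x\<close> keeps its value and flips the sign, so the
  terms cancel in pairs.\<close>

lemma alternating_sum_bounded_degree:
  assumes "bounded_degree D F" "finite U" "D < card U"
  shows "(\<Sum>I\<in>Pow U. (-1) ^ card I * F I) = 0"
  using assms(1)
proof induction
  case (monom J c)
  then obtain x where x: "x \<in> U" "x \<notin> J"
    using assms(3) card_mono by (metis leD le_trans subsetI)
  then have U: "U = insert x (U - {x})" by blast
  have card: "card (insert x I) = Suc (card I)" if "I \<subseteq> U - {x}" for I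
    using that assms(2) by (subst card_insert_disjoint) (auto intro: finite_subset)
  have J: "J \<subseteq> insert x I \<longleftrightarrow> J \<subseteq> I" for I
    using x(2) by blast
  show ?case
    by (subst U, subst sum_Pow_insert) (use assms(2) in \<open>auto simp: card J intro!: sum.neutral\<close>)
next
  case (add F G)
  then show ?case by (simp add: distrib_left sum.distrib)
qed

section \<open>Congruences modulo a prime\<close>

lemma int_fermat:
  fixes x :: int
  assumes "prime p" "\<not> int p dvd x"
  shows "int p dvd 1 - x ^ (p - 1)"
proof -
  have p: "p > 0" using assms(1) by (simp add: prime_gt_0_nat)
  define y where "y = nat (x mod int p)"
  have y: "int y = x mod int p" using p by (simp add: y_def)
  have "\<not> p dvd y"
    using assms(2) y by (metis dvd_mod_iff int_dvd_int_iff dvd_refl)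
  then have "[y ^ (p - 1) = 1] (mod p)" using fermat_theorem assms(1) by blast
  then have "[int y ^ (p - 1) = 1] (mod int p)"
    by (metis cong_int_iff of_nat_1 of_nat_power)
  moreover have "[int y ^ (p - 1) = x ^ (p - 1)] (mod int p)"
    unfolding y by (intro cong_pow) (simp add: cong_def)
  ultimately show ?thesis
    by (metis cong_iff_dvd_diff cong_sym cong_trans)
qed

text \<open>In Vandermonde's identity for \<open>w * p + p\<close> every mixed term contains
  \<open>p choose k\<close> with \<open>0 < k < p\<close>, a multiple of \<open>p\<close>. Hence
  each induction step adds 1 modulo \<open>p\<close>.\<close>

lemma binomial_mult_prime_cong:
  assumes "prime p"
  shows "[(w * p) choose p = w] (mod p)"
proof (induction w)
  case 0
  then show ?case using assms by (simp add: prime_gt_0_nat binomial_eq_0)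
next
  case (Suc w)
  have p: "p > 0" using assms by (simp add: prime_gt_0_nat)
  have inner: "p dvd (p choose k)" if "k \<in> {1..<p}" for k
    using dvd_choose_prime[of k p] that assms by auto
  have "{..p} = insert 0 (insert p {1..<p})" using p by auto
  then have "(Suc w * p) choose p =
      ((w * p) choose p) + (1 + (\<Sum>k\<in>{1..<p}. (p choose k) * ((w * p) choose (p - k))))"
    using p vandermonde[of p "w * p" p] by (simp add: add_ac)
  moreover have "p dvd (\<Sum>k\<in>{1..<p}. (p choose k) * ((w * p) choose (p - k)))"
    using inner by (intro dvd_sum) auto
  then have "[\<dots> = 0] (mod p)" by (simp add: cong_0_iff)
  ultimately show ?case
    using Suc cong_add[OF Suc cong_add[OF cong_refl[of 1 p]]] by fastforce
qed


section \<open>The polynomial method for zero-sum index sets\<close>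

text \<open>Sequences are indexed families, so that repeated terms stay distinct. Integer vectors
  replace residues so that vanishing sums can later be divided by \<open>n\<close>.\<close>

definition vanishing :: "nat \<Rightarrow> nat \<Rightarrow> ('a \<Rightarrow> nat \<Rightarrow> int) \<Rightarrow> 'a set \<Rightarrow> bool" where
  "vanishing n d f I \<longleftrightarrow> (\<forall>j<d. int n dvd (\<Sum>i\<in>I. f i j))"

lemma vanishing_Un_disjoint:
  assumes "vanishing n d f I" "vanishing n d f J" "I \<inter> J = {}" "finite I" "finite J"
  shows "vanishing n d f (I \<union> J)"
  using assms by (simp add: vanishing_def sum.union_disjoint)

lemma vanishing_Diff:
  assumes "vanishing n d f I" "vanishing n d f J" "J \<subseteq> I" "finite I"
  shows "vanishing n d f (I - J)"
  using assms by (simp add: vanishing_def sum_diff)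

text \<open>If no such \<open>I\<close> exists, the polynomial \<open>F\<close> below is divisible
  by \<open>p\<close> at every nonempty set but not at \<open>{}\<close>. Its degree is less than
  \<open>card U\<close>, so its alternating sum is 0, a contradiction.\<close>

lemma exists_vanishing_subset:
  fixes f :: "'a \<Rightarrow> nat \<Rightarrow> int"
  assumes p: "prime p" and U: "finite U" and T: "T \<subseteq> {1..<p}"
    and card: "(d + 1) * (p - 1) + card T * p < card U"
  obtains I where "I \<subseteq> U" "I \<noteq> {}" "p dvd card I" "vanishing p d f I" "card I div p mod p \<notin> T"
proof (rule ccontr)
  assume "\<not> thesis"
  then have contr: "card I div p mod p \<in> T"
    if "I \<subseteq> U" "I \<noteq> {}" "p dvd card I" "vanishing p d f I" for I
    using that \<open>\<And>I. I \<subseteq> U \<Longrightarrow> I \<noteq> {} \<Longrightarrow> p dvd card I \<Longrightarrow> vanishing p d f I \<Longrightarrow>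
      card I div p mod p \<notin> T \<Longrightarrow> thesis\<close> by blast
  have p0: "p > 0" using p by (simp add: prime_gt_0_nat)
  have finT: "finite T" using T finite_subset by blast
  define lin where "lin g I = (\<Sum>i\<in>U. g i * of_bool ({i} \<subseteq> I))" for g :: "'a \<Rightarrow> int" and I
  define bin :: "'a set \<Rightarrow> int"
    where "bin I = (\<Sum>J | J \<subseteq> U \<and> card J = p. 1 * of_bool (J \<subseteq> I))" for I
  \<comment> \<open>The first \<open>d + 1\<close> factors detect divisibility of the coordinate
    sums and of \<open>card I\<close> by \<open>p\<close>. The last product is 0 modulo
    \<open>p\<close> when, in addition, \<open>card I div p mod p\<close> lies in
    \<open>T\<close>.\<close>
  define F :: "'a set \<Rightarrow> int" where "F I = (\<Prod>j<d. 1 - lin (\<lambda>i. f i j) I ^ (p - 1)) * (1 - lin (\<lambda>i. 1) I ^ (p - 1)) *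
    (\<Prod>t\<in>T. int t - bin I)" for I
  have lin_eq: "lin g I = sum g I" if "I \<subseteq> U" for g I
    unfolding lin_def using that U by (intro sum.mono_neutral_cong_right) auto
  have bin_eq: "bin I = int (card I choose p)" if "I \<subseteq> U" for I
  proof -
    have "bin I = int (card {J. J \<subseteq> U \<and> card J = p \<and> J \<subseteq> I})"
      unfolding bin_def card_eq_sum of_nat_sum using U
      by (intro sum.mono_neutral_cong_right) auto
    also have "{J. J \<subseteq> U \<and> card J = p \<and> J \<subseteq> I} = {J. J \<subseteq> I \<and> card J = p}"
      using that by auto
    finally show ?thesis
      using n_subsets[of I p] that U finite_subset by metis
  qed
  have deg_lin: "bounded_degree 1 (lin g)" for g
    unfolding lin_def using U by (intro bounded_degree_sum bounded_degree.monom) auto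
  have deg_lin': "bounded_degree (p - 1) (\<lambda>I. 1 - lin g I ^ (p - 1))" for g
    using bounded_degree_diff_const[OF bounded_degree_power[OF deg_lin, of "p - 1" g]] by simp
  have deg_bin: "bounded_degree p (\<lambda>I. int t - bin I)" for t
    unfolding bin_def using U
    by (intro bounded_degree_diff_const bounded_degree_sum bounded_degree.monom)
      (auto intro: finite_subset)
  have "bounded_degree (d * (p - 1) + (p - 1) + card T * p) F"
    unfolding F_def
    using bounded_degree_prod[of "{..<d}" "p - 1" "\<lambda>j I. 1 - lin (\<lambda>i. f i j) I ^ (p - 1)"]
      bounded_degree_prod[of T p "\<lambda>t I. int t - bin I"] deg_lin' deg_bin finT
    by (intro bounded_degree_mult) auto
  then have "(\<Sum>I\<in>Pow U. (-1) ^ card I * F I) = 0"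
    by (rule alternating_sum_bounded_degree) (use U card in auto)
  moreover have "Pow U = insert {} (Pow U - {{}})" by auto
  ultimately have sum0: "F {} + (\<Sum>I\<in>Pow U - {{}}. (-1) ^ card I * F I) = 0"
    using U by (subst (asm) \<open>Pow U = _\<close>, subst (asm) sum.insert) auto
  have "int p dvd F I" if I: "I \<subseteq> U" "I \<noteq> {}" for I
  proof (cases "p dvd card I \<and> vanishing p d f I")
    case True
    define w where "w = card I div p"
    have w: "card I = w * p" using True by (simp add: w_def)
    have t: "w mod p \<in> T" using contr I True w_def by blast
    have "[int (card I choose p) = int w] (mod int p)"
      using binomial_mult_prime_cong[OF p, of w] w cong_int_iff by simp
    moreover have "[int w = int (w mod p)] (mod int p)"
      by (simp add: zmod_int cong_def)
    ultimately have "int p dvd int (w mod p) - bin I"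
      using bin_eq[OF I(1)] by (metis cong_iff_dvd_diff cong_sym cong_trans)
    then have "int p dvd (\<Prod>t\<in>T. int t - bin I)"
      using dvd_prodI[OF finT t, of "\<lambda>t. int t - bin I"] by (rule dvd_trans)
    then show ?thesis by (simp add: F_def)
  next
    case False
    then consider "\<not> int p dvd lin (\<lambda>i. 1) I"
      | j where "j < d" "\<not> int p dvd lin (\<lambda>i. f i j) I"
      using lin_eq[OF I(1)] by (auto simp: vanishing_def)
    then show ?thesis
    proof cases
      case 1
      then show ?thesis using int_fermat[OF p] by (simp add: F_def)
    next
      case 2
      have "(1 - lin (\<lambda>i. f i j) I ^ (p - 1)) dvd (\<Prod>j<d. 1 - lin (\<lambda>i. f i j) I ^ (p - 1))"
        using 2 by (intro dvd_prodI) auto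
      with int_fermat[OF p 2(2)] have "int p dvd (\<Prod>j<d. 1 - lin (\<lambda>i. f i j) I ^ (p - 1))"
        by (rule dvd_trans)
      then show ?thesis by (simp add: F_def)
    qed
  qed
  then have "int p dvd (\<Sum>I\<in>Pow U - {{}}. (-1) ^ card I * F I)"
    by (intro dvd_sum dvd_mult) auto
  moreover have "F {} = - (\<Sum>I\<in>Pow U - {{}}. (-1) ^ card I * F I)"
    using sum0 by simp
  ultimately have "int p dvd F {}" by simp
  \<comment> \<open>At \<open>{}\<close> all linear forms and \<open>bin\<close> are 0; as
    \<open>p - 1 > 0\<close>, every Fermat factor is 1.\<close>
  moreover have "F {} = int (\<Prod>T)"
    using prime_gt_1_nat[OF p] p0 by (simp add: F_def lin_eq bin_eq binomial_eq_0 power_0_left)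
  ultimately have "p dvd \<Prod>T" by (metis int_dvd_int_iff)
  then obtain t where "t \<in> T" "p dvd t"
    using prime_dvd_prod_iff[OF finT p, of "\<lambda>t. t"] by auto
  then show False using T nat_dvd_not_less[of t p] by force
qed

section \<open>Zero-sum lengths for a prime modulus\<close>

definition zero_lengths :: "nat \<Rightarrow> nat \<Rightarrow> ('a \<Rightarrow> nat \<Rightarrow> int) \<Rightarrow> 'a set \<Rightarrow> nat set" where
  "zero_lengths p d f U = {w. \<exists>I\<subseteq>U. card I = w * p \<and> vanishing p d f I}"

lemma zero_lengths_mono: "U \<subseteq> V \<Longrightarrow> zero_lengths p d f U \<subseteq> zero_lengths p d f V"
  unfolding zero_lengths_def by blast

text \<open>If at least \<open>d\<close> lengths were missing, the lengths present would form a
  forbidden set \<open>T\<close> of size at most \<open>M - d\<close>. The polynomial method then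
  yields a length in \<open>{1..M}\<close> outside \<open>T\<close>, which is both missing and
  present.\<close>

lemma card_missing_zero_lengths:
  assumes p: "prime p" and U: "finite U" and d: "0 < d" "d \<le> p" and M: "M < p"
    and card: "(M + 1) * p - d \<le> card U"
  shows "card ({1..M} - zero_lengths p d f U) \<le> d - 1"
proof (rule ccontr)
  define X where "X = {1..M} - zero_lengths p d f U"
  assume "\<not> ?thesis"
  then have cX: "d \<le> card X" using d by (simp add: X_def)
  have finX: "finite X" by (simp add: X_def)
  have "card X \<le> M" using card_mono[of "{1..M}" X] by (auto simp: X_def)
  then have dM: "d \<le> M" using cX by simp
  \<comment> \<open>Trimming to fewer than \<open>(M + 1) * p\<close> indices forces the length
    found to be at most \<open>M < p\<close>, so reduction modulo \<open>p\<close> does not change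
    it.\<close>
  obtain V where V: "V \<subseteq> U" "card V = (M + 1) * p - d"
    using card by (meson obtain_subset_with_card_n)
  define T where "T = {1..M} - X"
  have "card T = M - card X"
    unfolding T_def by (subst card_Diff_subset) (auto simp: X_def)
  then have cT: "card T \<le> M - d" using cX by simp
  obtain e where e: "M = d + e" using dM le_Suc_ex by blast
  obtain q where q: "p = Suc q" using M by (cases p) auto
  have "(d + 1) * (p - 1) + card T * p \<le> (d + 1) * (p - 1) + e * p"
    using cT e by (intro add_left_mono mult_right_mono) auto
  \<comment> \<open>The left side equals \<open>(M + 1) * p - d - 1\<close>.\<close>
  also have "\<dots> < (M + 1) * p - d"
    using q e by (simp add: algebra_simps)
  finally have card': "(d + 1) * (p - 1) + card T * p < card V" using V by simp
  have finV: "finite V" using V U finite_subset by blast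
  have subT: "T \<subseteq> {1..<p}" using M by (auto simp: T_def)
  obtain I where I: "I \<subseteq> V" "I \<noteq> {}" "p dvd card I" "vanishing p d f I"
      "card I div p mod p \<notin> T"
    by (rule exists_vanishing_subset[OF p finV subT card'])
  define w where "w = card I div p"
  have w: "card I = w * p" using I(3) by (simp add: w_def)
  have "w * p \<le> (M + 1) * p - d" using card_mono[OF finV I(1)] V w by simp
  also have "\<dots> < (M + 1) * p" using d q by simp
  finally have "w \<le> M" by (metis Suc_eq_plus1 less_Suc_eq_le mult_less_cancel2)
  moreover have "0 < card I" using I finV by (meson card_gt_0_iff finite_subset)
  then have "0 < w" using w by simp
  ultimately have wM: "w \<in> {1..M}" by simp
  then have "w \<in> X" using I(5) M by (simp add: T_def flip: w_def)
  moreover have "w \<in> zero_lengths p d f U"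
    unfolding zero_lengths_def using I w V by blast
  ultimately show False by (simp add: X_def)
qed

lemma zero_lengths_complement:
  assumes "finite W" "card W = w * p" "vanishing p d f W" "u \<in> zero_lengths p d f W"
  shows "w - u \<in> zero_lengths p d f W"
proof -
  obtain I where I: "I \<subseteq> W" "card I = u * p" "vanishing p d f I"
    using assms(4) by (auto simp: zero_lengths_def)
  then have "card (W - I) = (w - u) * p"
    using assms(1,2) by (simp add: card_Diff_subset finite_subset diff_mult_distrib)
  then show ?thesis
    using I assms vanishing_Diff unfolding zero_lengths_def by blast
qed

lemma zero_lengths_add:
  assumes "finite U" "finite V" "U \<inter> V = {}" "u \<in> zero_lengths p d f U" "v \<in> zero_lengths p d f V"
  shows "u + v \<in> zero_lengths p d f (U \<union> V)"
proof -
  obtain I J where I: "I \<subseteq> U" "card I = u * p" "vanishing p d f I"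
    and J: "J \<subseteq> V" "card J = v * p" "vanishing p d f J"
    using assms(4,5) by (auto simp: zero_lengths_def)
  have fin: "finite I" "finite J" "I \<inter> J = {}"
    using I J assms finite_subset by blast+
  then have "card (I \<union> J) = (u + v) * p"
    using I J by (simp add: card_Un_disjoint distrib_right)
  moreover have "vanishing p d f (I \<union> J)"
    using vanishing_Un_disjoint I J fin by blast
  ultimately show ?thesis
    using I J unfolding zero_lengths_def by blast
qed

text \<open>
  The missing lengths of a vanishing set are symmetric about half its length, so at most about
  half of them can lie below \<^term>\<open>k\<close>.
\<close>

lemma card_missing_zero_lengths_vanishing:
  assumes p: "prime p" and d: "0 < d" "d \<le> k" and w: "k + d \<le> w" "w \<le> p"
    and W: "finite W" "card W = w * p" "vanishing p d f W"
    and k: "k \<notin> zero_lengths p d f W"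
  shows "2 * card ({1..<k} - zero_lengths p d f W) + 2 \<le> k"
proof -
  define L where "L = zero_lengths p d f W"
  \<comment> \<open>\<open>Y\<close> includes the missing \<open>k\<close> itself, which accounts
    for the \<open>+ 2\<close> in the claim. The reflection \<open>R\<close> of \<open>Y\<close> is
    missing as well.\<close>
  define Y where "Y = {1..k} - L"
  define R where "R = (\<lambda>u. w - u) ` Y"
  have "Y = insert k ({1..<k} - L)"
    using k d by (auto simp: Y_def L_def)
  then have cY: "card Y = Suc (card ({1..<k} - L))" by simp
  have "inj_on (\<lambda>u. w - u) Y"
    using w d by (auto simp: inj_on_def Y_def)
  then have cR: "card R = card Y" by (simp add: R_def card_image)
  have fin: "finite Y" "finite R" by (simp_all add: Y_def R_def)
  have "Y \<union> R \<subseteq> {1..w - 1} - L"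
  proof -
    have "w - u \<notin> L" if "u \<in> Y" for u
      using zero_lengths_complement[OF W, of "w - u"] that w by (auto simp: Y_def L_def)
    then show ?thesis using w d by (auto simp: Y_def R_def)
  qed
  then have "card (Y \<union> R) \<le> card ({1..w - 1} - L)" by (intro card_mono) auto
  also have "\<dots> \<le> d - 1"
    unfolding L_def using p W w d
    by (intro card_missing_zero_lengths) auto
  finally have 1: "card (Y \<union> R) \<le> d - 1" .
  have "card (Y \<inter> R) \<le> card {w - k..k}"
    by (intro card_mono) (auto simp: Y_def R_def)
  then have 2: "card (Y \<inter> R) \<le> Suc k - (w - k)" by simp
  have "card Y + card R = card (Y \<union> R) + card (Y \<inter> R)"
    using fin by (rule card_Un_Int)
  \<comment> \<open>Twice \<open>card Y\<close> is at most
    \<open>(d - 1) + max 0 (2 * k + 1 - w)\<close>, which is at most \<open>k\<close> because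
    \<open>k + d \<le> w\<close> and \<open>d \<le> k\<close>.\<close>
  then show ?thesis
    using 1 2 w d unfolding cR cY L_def by linarith
qed

text \<open>Pigeonhole: the numbers missing from \<open>A\<close> and the reflections of those
  missing from \<open>B\<close> are too few to cover \<open>{1..<k}\<close>.\<close>

lemma exists_complementary_lengths:
  fixes k :: nat
  assumes "card ({1..<k} - A) + card ({1..<k} - B) < k - 1"
  obtains u where "u \<in> A" "k - u \<in> B" "0 < u" "u < k"
proof -
  define C where "C = (\<lambda>v. k - v) ` ({1..<k} - B)"
  have "card (({1..<k} - A) \<union> C) \<le> card ({1..<k} - A) + card ({1..<k} - B)"
    unfolding C_def by (meson card_Un_le card_image_le finite_Diff finite_atLeastLessThan
      nat_add_left_cancel_le order_trans)
  also have "\<dots> < card {1..<k}" using assms by simp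
  finally obtain u where u: "u \<in> {1..<k}" "u \<notin> ({1..<k} - A) \<union> C"
    by (metis card_mono finite_Diff finite_Un finite_atLeastLessThan finite_imageI C_def leD subsetI)
  have "u = k - (k - u)" using u by auto
  then have "k - u \<in> B" using u unfolding C_def by (smt (verit) Diff_iff Un_iff atLeastLessThan_iff
    diff_less image_eqI less_le_trans zero_less_diff zero_less_one Suc_leI One_nat_def)
  then show ?thesis using that u by auto
qed

lemma mem_zero_lengths:
  assumes p: "prime p" and d: "0 < d" "3 * d \<le> p + 1"
    and "d \<le> k" "finite U" "(k + 5 * d - 3) * p \<le> card U"
  shows "k \<in> zero_lengths p d f U"
  using assms(4-)
proof (induction k arbitrary: U rule: less_induct)
  case (less k)
  show ?case
  proof (rule ccontr)
    assume k: "k \<notin> zero_lengths p d f U"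
    have p0: "p > 0" using p by (simp add: prime_gt_0_nat)
    \<comment> \<open>The largest value for which \<open>3 * d \<le> p + 1\<close> guarantees
      \<open>M < p\<close>.\<close>
    define M where "M = 3 * d - 2"
    have small: "u \<notin> zero_lengths p d f U" if u: "0 < u" "u \<le> k - d" for u
    proof
      assume "u \<in> zero_lengths p d f U"
      then obtain I where I: "I \<subseteq> U" "card I = u * p" "vanishing p d f I"
        by (auto simp: zero_lengths_def)
      have finI: "finite I" using I less.prems finite_subset by blast
      \<comment> \<open>Removing \<open>u * p\<close> indices lowers the required size exactly as
        much as replacing \<open>k\<close> by \<open>k - u\<close>.\<close>
      have "(k + 5 * d - 3) * p - u * p = (k - u + 5 * d - 3) * p"
        using u d by (simp flip: diff_mult_distrib)
      then have "(k - u + 5 * d - 3) * p \<le> card (U - I)"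
        using less.prems I finI by (simp add: card_Diff_subset)
      then have "k - u \<in> zero_lengths p d f (U - I)"
        using less.IH[of "k - u" "U - I"] u less.prems d by simp
      moreover have "u \<in> zero_lengths p d f I" using I by (auto simp: zero_lengths_def)
      ultimately have "u + (k - u) \<in> zero_lengths p d f (I \<union> (U - I))"
        using less.prems finI by (intro zero_lengths_add) auto
      moreover have "I \<union> (U - I) = U" using I by auto
      ultimately show False using k u by simp
    qed
    have missing: "card ({1..m} - zero_lengths p d f V) \<le> d - 1"
      if "m \<le> M" "(M + 1) * p \<le> card V" "finite V" for m V
    proof -
      have "card ({1..m} - zero_lengths p d f V) \<le> card ({1..M} - zero_lengths p d f V)"
        using that by (intro card_mono) auto
      also have "\<dots> \<le> d - 1"
        using that p d M_def by (intro card_missing_zero_lengths) auto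
      finally show ?thesis .
    qed
    have cardU: "(M + 1) * p \<le> card U"
    proof -
      have "(M + 1) * p \<le> (k + 5 * d - 3) * p" 
        using less.prems d by (intro mult_right_mono) (auto simp: M_def)
      then show ?thesis using less.prems by simp
    qed
    have pick: "\<exists>w W. W \<subseteq> V \<and> card W = w * p \<and> vanishing p d f W \<and> k + d \<le> w \<and> w \<le> M"
      if V: "V \<subseteq> U" "(M + 1) * p \<le> card V" for V
    proof (rule ccontr)
      assume contr: "\<not> ?thesis"
      have finV: "finite V" using V less.prems finite_subset by blast
      have sub: "zero_lengths p d f V \<subseteq> zero_lengths p d f U" using V(1) by (rule zero_lengths_mono)
      have big: "w \<notin> zero_lengths p d f V" if "k + d \<le> w" "w \<le> M" for w
        using that contr by (auto simp: zero_lengths_def)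
      have 1: "w \<notin> zero_lengths p d f V" if "w \<in> {1..k - d} \<union> {k} \<union> {k + d..M}" for w
        using that sub k small[of w] big[of w] by auto
      show False
      proof (cases "k < 2 * d - 1")
        case True
        \<comment> \<open>These three disjoint sets have \<open>d\<close> elements in total, one
          more than may be missing.\<close>
        have "({1..k - d} \<union> {k}) \<union> {k + d..M} \<subseteq> {1..M} - zero_lengths p d f V"
          using 1 True d less.prems by (auto simp: M_def)
        then have "card (({1..k - d} \<union> {k}) \<union> {k + d..M}) \<le> d - 1"
          using missing[of M V] finV V(2) by (meson card_mono finite_Diff finite_atLeastAtMost le_refl order_trans)
        moreover have "card (({1..k - d} \<union> {k}) \<union> {k + d..M}) = (k - d) + 1 + (M + 1 - (k + d))"
          using d less.prems by (subst card_Un_disjoint; simp)+ 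
        ultimately show False using True less.prems d by (simp add: M_def)
      next
        case False
        \<comment> \<open>A \<open>d\<close>-th missing length besides \<open>1, ..., d - 1\<close>:
          it is \<open>k\<close> if \<open>k = 2 * d - 1\<close>, and otherwise \<open>d\<close>,
          since then \<open>d \<le> k - d\<close>.\<close>
        define x where "x = (if k < 2 * d then k else d)"
        have "insert x {1..d - 1} \<subseteq> {1..k - d} \<union> {k}" "insert x {1..d - 1} \<subseteq> {1..M}"
          using False d less.prems by (auto simp: M_def x_def)
        then have "insert x {1..d - 1} \<subseteq> {1..M} - zero_lengths p d f V"
          using 1 by blast
        then have "card (insert x {1..d - 1}) \<le> d - 1"
          using missing[of M V] finV V(2) by (meson card_mono finite_Diff finite_atLeastAtMost le_refl order_trans)
        moreover have "x \<notin> {1..d - 1}" using d less.prems by (auto simp: x_def)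
        ultimately show False using d by simp
      qed
    qed
    obtain w1 W1 where W1: "W1 \<subseteq> U" "card W1 = w1 * p" "vanishing p d f W1" "k + d \<le> w1" "w1 \<le> M"
      using pick[OF order_refl cardU] by blast
    have finW1: "finite W1" using W1 less.prems finite_subset by blast
    \<comment> \<open>Here \<open>k + 5 * d - 3\<close> suffices:
      \<open>(3 * d - 1) + (3 * d - 2) = 6 * d - 3\<close> and \<open>d \<le> k\<close>.\<close>
    have "(M + 1) * p + w1 * p \<le> (k + 5 * d - 3) * p"
      unfolding distrib_right[symmetric] using W1 less.prems d by (intro mult_right_mono) (auto simp: M_def)
    then have "(M + 1) * p \<le> card (U - W1)"
      using less.prems W1 finW1 by (simp add: card_Diff_subset)
    then obtain w2 W2 where W2: "W2 \<subseteq> U - W1" "card W2 = w2 * p" "vanishing p d f W2" "k + d \<le> w2" "w2 \<le> M"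
      using pick[of "U - W1"] by blast
    have finW2: "finite W2" using W2 less.prems finite_subset by blast
    have "k \<notin> zero_lengths p d f W1" "k \<notin> zero_lengths p d f W2"
      using k zero_lengths_mono[of _ U p d f] W1 W2 by blast+
    then have "2 * card ({1..<k} - zero_lengths p d f W1) + 2 \<le> k"
      "2 * card ({1..<k} - zero_lengths p d f W2) + 2 \<le> k"
      using W1 W2 finW1 finW2 p d less.prems M_def
      by (intro card_missing_zero_lengths_vanishing[of p d k]; simp)+
    then have "card ({1..<k} - zero_lengths p d f W1) + card ({1..<k} - zero_lengths p d f W2) < k - 1"
      by linarith
    then obtain u where u: "u \<in> zero_lengths p d f W1" "k - u \<in> zero_lengths p d f W2" "0 < u" "u < k"
      by (rule exists_complementary_lengths)
    have "u + (k - u) \<in> zero_lengths p d f (W1 \<union> W2)"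
      using u finW1 finW2 W2 by (intro zero_lengths_add) auto
    then have "k \<in> zero_lengths p d f (W1 \<union> W2)" using u by simp
    then show False
      using k zero_lengths_mono[of "W1 \<union> W2" U p d f] W1 W2 by blast
  qed
qed

section \<open>From prime to composite moduli\<close>

definition vanishing_bound :: "nat \<Rightarrow> nat \<Rightarrow> nat \<Rightarrow> nat \<Rightarrow> bool" where
  "vanishing_bound m n d l \<longleftrightarrow>
    (\<forall>(f :: nat \<Rightarrow> nat \<Rightarrow> int) U. finite U \<and> l \<le> card U \<longrightarrow> (\<exists>I\<subseteq>U. card I = m \<and> vanishing n d f I))"

lemma vanishing_bound_mono: "vanishing_bound m n d l \<Longrightarrow> l \<le> l' \<Longrightarrow> vanishing_bound m n d l'"
  unfolding vanishing_bound_def by (meson order_trans)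

lemma vanishing_bound_prime:
  assumes "prime p" "0 < d" "3 * d \<le> p + 1" "d \<le> k"
  shows "vanishing_bound (k * p) p d ((k + 5 * d - 3) * p)"
  using mem_zero_lengths[OF assms] unfolding vanishing_bound_def zero_lengths_def by blast

text \<open>Greedy choice: after \<open>t - 1\<close> blocks of size \<open>m\<close> are removed,
  \<open>l\<close> indices remain for the last one.\<close>

lemma vanishing_bound_disjoint:
  fixes f :: "nat \<Rightarrow> nat \<Rightarrow> int"
  assumes "vanishing_bound m n d l" "finite U" "(t - 1) * m + l \<le> card U"
  shows "\<exists>g. (\<forall>i<t. g i \<subseteq> U \<and> card (g i) = m \<and> vanishing n d f (g i)) \<and> disjoint_family_on g {..<t}"
  using assms(2,3)
proof (induction t arbitrary: U)
  case 0
  then show ?case by (simp add: disjoint_family_on_def)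
next
  case (Suc t)
  have "l \<le> card U" using Suc.prems by simp
  then obtain I where I: "I \<subseteq> U" "card I = m" "vanishing n d f I"
    using assms(1) Suc.prems unfolding vanishing_bound_def by blast
  have "finite I" using I Suc.prems finite_subset by blast
  then have cUI: "card (U - I) = card U - m"
    using I by (simp add: card_Diff_subset)
  show ?case
  \<comment> \<open>Since \<open>0 - 1 = 0\<close>, the induction hypothesis for zero further blocks
    would still demand \<open>l\<close> remaining indices, so a single block is treated
    apart.\<close>
  proof (cases t)
    case 0
    then show ?thesis using I by (intro exI[of _ "\<lambda>_. I"]) (auto simp: disjoint_family_on_def)
  next
    case t: (Suc t')
    have "(t - 1) * m + l \<le> card (U - I)"
      using Suc.prems cUI t by simp
    then obtain g where g: "\<And>i. i < t \<Longrightarrow> g i \<subseteq> U - I \<and> card (g i) = m \<and> vanishing n d f (g i)"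
        "disjoint_family_on g {..<t}"
      using Suc.IH[of "U - I"] Suc.prems(1) by auto
    have "disjoint_family_on (g(t := I)) {..<Suc t}"
      unfolding disjoint_family_on_def
    proof (intro ballI impI)
      fix i j assume ij: "i \<in> {..<Suc t}" "j \<in> {..<Suc t}" "i \<noteq> j"
      then consider "i < t" "j < t" | "i = t" "j < t" | "i < t" "j = t" by force
      then show "(g(t := I)) i \<inter> (g(t := I)) j = {}"
        using g ij by cases (auto simp: disjoint_family_on_def)
    qed
    moreover have "\<forall>i<Suc t. (g(t := I)) i \<subseteq> U \<and> card ((g(t := I)) i) = m \<and> vanishing n d f ((g(t := I)) i)"
      using g(1) I by (auto simp: less_Suc_eq)
    ultimately show ?thesis by blast
  qed
qed

lemma vanishing_bound_mult:
  assumes 1: "vanishing_bound m' n' d l'" and 2: "vanishing_bound m n d l"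
    and "0 < n" "0 < m"
  shows "vanishing_bound (m' * m) (n' * n) d ((l' - 1) * m + l)"
  unfolding vanishing_bound_def
proof (intro allI impI, elim conjE)
  fix f :: "nat \<Rightarrow> nat \<Rightarrow> int" and U :: "nat set"
  assume U: "finite U" "(l' - 1) * m + l \<le> card U"
  obtain g :: "nat \<Rightarrow> nat set" where g: "\<And>i. i < l' \<Longrightarrow> g i \<subseteq> U" "\<And>i. i < l' \<Longrightarrow> card (g i) = m"
      "\<And>i. i < l' \<Longrightarrow> vanishing n d f (g i)" "disjoint_family_on g {..<l'}"
    using vanishing_bound_disjoint[OF 2 U, of f] by blast
  \<comment> \<open>The block sums divided by \<open>n\<close> form a new family of
    \<open>l'\<close> vectors; a union of blocks vanishes modulo \<open>n' * n\<close> once their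
    quotients vanish modulo \<open>n'\<close>.\<close>
  define h where "h i j = (\<Sum>x\<in>g i. f x j) div int n" for i j
  obtain J where J: "J \<subseteq> {..<l'}" "card J = m'" "vanishing n' d h J"
    using 1[unfolded vanishing_bound_def, rule_format, of "{..<l'}" h] by auto
  have finJ: "finite J" using J finite_subset by blast
  have fing: "finite (g i)" if "i \<in> J" for i
    using that J g(1) U finite_subset by (meson lessThan_iff subsetD)
  have disj: "g i \<inter> g j = {}" if "i \<in> J" "j \<in> J" "i \<noteq> j" for i j
    using that J g(4) unfolding disjoint_family_on_def by blast
  define I where "I = (\<Union>i\<in>J. g i)"
  have "card I = (\<Sum>i\<in>J. card (g i))"
    unfolding I_def using finJ fing disj by (intro card_UN_disjoint) auto
  also have "\<dots> = (\<Sum>i\<in>J. m)"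
    using g(2) J by (intro sum.cong) auto
  finally have "card I = m' * m" using J by simp
  moreover have "vanishing (n' * n) d f I"
    unfolding vanishing_def
  proof (intro allI impI)
    fix j assume j: "j < d"
    have "(\<Sum>x\<in>I. f x j) = (\<Sum>i\<in>J. \<Sum>x\<in>g i. f x j)"
      unfolding I_def using finJ fing disj by (intro sum.UNION_disjoint) auto
    also have "\<dots> = (\<Sum>i\<in>J. int n * h i j)"
    proof (intro sum.cong refl)
      fix i assume "i \<in> J"
      then have "int n dvd (\<Sum>x\<in>g i. f x j)" using g(3) J j unfolding vanishing_def by blast
      then show "(\<Sum>x\<in>g i. f x j) = int n * h i j" by (simp add: h_def)
    qed
    also have "\<dots> = int n * (\<Sum>i\<in>J. h i j)" by (simp add: sum_distrib_left)
    finally show "int (n' * n) dvd (\<Sum>x\<in>I. f x j)"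
      using J(3) j by (simp add: vanishing_def mult.commute mult_dvd_mono)
  qed
  moreover have "I \<subseteq> U" using g(1) J by (auto simp: I_def)
  ultimately show "\<exists>I\<subseteq>U. card I = m' * m \<and> vanishing (n' * n) d f I" by blast
qed

text \<open>Subtracting \<^term>\<open>c\<close> strengthens the bound enough for the induction to close.\<close>

lemma vanishing_bound_prod:
  fixes p a :: "nat \<Rightarrow> nat"
  assumes d: "0 < d"
    and pr: "\<And>i. i \<in> {1..r} \<Longrightarrow> prime (p i)"
    and p: "\<And>i. i \<in> {1..r} \<Longrightarrow> 3 * d \<le> p i + 1"
    and a: "\<And>i. i \<in> {1..r} \<Longrightarrow> d \<le> a i"
    and c: "\<And>i. i \<in> {1..r} \<Longrightarrow> (5 * d - 3) * p i + c \<le> c * (a i * p i)"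
  shows "vanishing_bound ((\<Prod>i=1..r. a i) * (\<Prod>i=1..r. p i)) (\<Prod>i=1..r. p i) d
    ((c + 1) * ((\<Prod>i=1..r. a i) * (\<Prod>i=1..r. p i)) - c)"
  using assms(2-)
proof (induction r)
  case 0
  have "\<exists>I\<subseteq>U. card I = 1 \<and> vanishing 1 d f I" if "finite U" "1 \<le> card U"
    for U and f :: "nat \<Rightarrow> nat \<Rightarrow> int"
    using that by (metis Suc_leI obtain_subset_with_card_n of_nat_1 one_dvd vanishing_def)
  then show ?case by (simp add: vanishing_bound_def)
next
  case (Suc r)
  define K where "K = (\<Prod>i=1..r. a i) * (\<Prod>i=1..r. p i)"
  define q b where "q = p (Suc r)" and "b = a (Suc r)"
  have q: "prime q" "3 * d \<le> q + 1" "d \<le> b" "(5 * d - 3) * q + c \<le> c * (b * q)"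
    using Suc.prems by (auto simp: q_def b_def)
  have "0 < a i" "0 < p i" if "i \<in> {1..r}" for i
    using Suc.prems(1)[of i] Suc.prems(3)[of i] that d prime_gt_0_nat by fastforce+
  then have "0 < K" by (auto simp: K_def intro!: prod_pos)
  then obtain e where e: "K = Suc e" using gr0_implies_Suc by blast
  have IH: "vanishing_bound K (\<Prod>i=1..r. p i) d ((c + 1) * K - c)"
    unfolding K_def by (rule Suc.IH) (use Suc.prems in auto)
  \<comment> \<open>The new prime \<open>q\<close> produces the blocks; the induction hypothesis is
    applied to their divided sums.\<close>
  have "vanishing_bound (K * (b * q)) ((\<Prod>i=1..r. p i) * q) d
      (((c + 1) * K - c - 1) * (b * q) + (b + 5 * d - 3) * q)"
    using q d by (intro vanishing_bound_mult IH vanishing_bound_prime) (auto simp: prime_gt_0_nat)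
  moreover have "((c + 1) * K - c - 1) * (b * q) + (b + 5 * d - 3) * q \<le> (c + 1) * (K * (b * q)) - c"
  proof -
    \<comment> \<open>Subtracting \<open>c\<close> and one more saves \<open>c + 1\<close> whole
      blocks of size \<open>b * q\<close>. One of them covers \<open>b * q\<close>, and by
      hypothesis the other \<open>c\<close> cover \<open>(5 * d - 3) * q + c\<close>.\<close>
    have 1: "(c + 1) * K - c - 1 = (c + 1) * e" by (simp add: e)
    have "b + 5 * d - 3 = b + (5 * d - 3)" using d by simp
    then have 2: "(b + 5 * d - 3) * q = b * q + (5 * d - 3) * q" by (simp only: distrib_right)
    have "(c + 1) * (K * (b * q)) = (c + 1) * e * (b * q) + b * q + c * (b * q)"
      by (simp add: e algebra_simps)
    then show ?thesis using 1 2 q(4) by simp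
  qed
  ultimately show ?case
    using vanishing_bound_mono by (simp add: K_def q_def b_def mult_ac)
qed

section \<open>Transfer to sequences over the group\<close>

lemma seq_sum_cyclic_power:
  assumes "0 < n" "seq_over (cyclic_power n d) S"
  shows "seq_sum (cyclic_power n d) S = (\<lambda>j\<in>{..<d}. (\<Sum>x\<in>#S. x j) mod int n)"
  using assms(2)
proof (induction S)
  case empty
  then show ?case
    by (simp add: seq_sum_empty[OF comm_group_cyclic_power]) (simp add: cyclic_power_def)
next
  case (add x S)
  then have "x \<in> carrier (cyclic_power n d)" "seq_over (cyclic_power n d) S"
    by (auto simp: seq_over_def)
  then show ?case
    using add.IH seq_sum_add_mset[OF comm_group_cyclic_power]
    by (simp add: cyclic_power_def restrict_def fun_eq_iff mod_simps)
qed

text \<open>Listing the terms of \<open>S\<close> turns it into a family indexed by positions; a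
  vanishing set of positions gives a zero-sum sub-multiset of the same size.\<close>

lemma s_const_cyclic_power_le:
  assumes n: "0 < n" and l: "0 < l" and bound: "vanishing_bound m n d l"
  shows "s_const m (cyclic_power n d) \<le> enat l"
proof -
  have "\<exists>T. T \<subseteq># S \<and> size T = m \<and> zero_sum (cyclic_power n d) T"
    if S: "seq_over (cyclic_power n d) S" "l \<le> size S" for S
  proof -
    obtain xs where xs: "mset xs = S" using ex_mset by blast
    obtain I where I: "I \<subseteq> {..<length xs}" "card I = m" "vanishing n d (\<lambda>i. xs ! i) I"
      using bound[unfolded vanishing_bound_def, rule_format, of "{..<length xs}" "\<lambda>i. xs ! i"] S xs
      by auto
    define T where "T = image_mset ((!) xs) (mset_set I)"
    have "mset_set I \<subseteq># mset_set {..<length xs}"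
      using I(1) by (simp add: subset_imp_msubset_mset_set)
    then have "T \<subseteq># image_mset ((!) xs) (mset_set {..<length xs})"
      unfolding T_def by (rule image_mset_subseteq_mono)
    also have "\<dots> = S"
      using xs by (metis atLeast0LessThan map_nth mset_map mset_upt)
    finally have TS: "T \<subseteq># S" .
    then have "seq_over (cyclic_power n d) T"
      using S set_mset_mono unfolding seq_over_def by blast
    moreover have "(\<Sum>x\<in>#T. x j) mod int n = 0" if "j < d" for j
      using I(3) that by (simp add: T_def vanishing_def sum_unfold_sum_mset image_mset.compositionality comp_def)
    ultimately have "zero_sum (cyclic_power n d) T"
      unfolding zero_sum_def using n
      by (simp add: seq_sum_cyclic_power) (simp add: cyclic_power_def restrict_def fun_eq_iff)
    then show ?thesis
      using TS I(2) by (auto simp: T_def)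
  qed
  then show ?thesis
    unfolding s_const_def using l by (intro Inf_lower) blast
qed

theorem corollary14:
  fixes d n k r :: nat and p a :: "nat \<Rightarrow> nat"
  assumes "0 < d"
    and "n = (\<Prod>i=1..r. p i)"
    and "\<And>i. i \<in> {1..r} \<Longrightarrow> prime (p i)"
    and "\<And>i. i \<in> {1..r} \<Longrightarrow> real (p i) \<ge> 7 / 2 * real d - 3"
    and "k = (\<Prod>i=1..r. a i)"
    and "\<And>i. i \<in> {1..r} \<Longrightarrow> 0 < a i"
    and "\<And>i. i \<in> {1..r} \<Longrightarrow> a i \<ge> d"
  shows "s_const (k * n) (cyclic_power n d) \<le> enat (9 * k * n) \<and>
    ((\<forall>i\<in>{1..r}. real (p i) \<ge> 4 * real d - 2 \<and> a i \<ge> p i + d) \<longrightarrow>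
       s_const (k * n) (cyclic_power n d) \<le> enat (3 * k * n))"
proof -
  have p0: "2 \<le> p i" if "i \<in> {1..r}" for i
    using assms(3) that prime_ge_2_nat by blast
  have pd: "3 * d \<le> p i + 1" if i: "i \<in> {1..r}" for i
  proof -
    have "7 * d \<le> 2 * p i + 6" using assms(4)[OF i] by linarith
    \<comment> \<open>Among integers \<open>p i \<ge> 2\<close>, the inequality
      \<open>7 * d \<le> 2 * p i + 6\<close> fails to give \<open>3 * d \<le> p i + 1\<close> only
      for \<open>p i = 4\<close>, \<open>d = 2\<close>.\<close>
    moreover have "p i \<noteq> 4" using assms(3)[OF i] by (auto simp: prime_nat_iff dest: spec[of _ 2])
    ultimately show ?thesis using p0[OF i] by presburger
  qed
  have n: "0 < n" unfolding assms(2) using p0 by (fastforce intro: prod_pos)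
  have k: "0 < k" unfolding assms(5) using assms(6) by (fastforce intro: prod_pos)
  have bound: "s_const (k * n) (cyclic_power n d) \<le> enat ((c + 1) * k * n)"
    if c: "\<And>i. i \<in> {1..r} \<Longrightarrow> (5 * d - 3) * p i + c \<le> c * (a i * p i)" for c
  proof -
    have "vanishing_bound (k * n) n d ((c + 1) * (k * n) - c)"
      unfolding assms(2,5) using assms(1,3,7) pd c by (intro vanishing_bound_prod)
    then have "vanishing_bound (k * n) n d ((c + 1) * k * n)"
      by (rule vanishing_bound_mono) (simp only: mult.assoc diff_le_self)
    then show ?thesis using n k by (intro s_const_cyclic_power_le) auto
  qed
  obtain e where e: "d = Suc e" using assms(1) gr0_implies_Suc by blast
  \<comment> \<open>For \<open>c = 8\<close>, \<open>a i \<ge> d\<close> leaves a surplus of at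
    least \<open>(3 * d + 3) * p i \<ge> 12\<close>.\<close>
  have "(5 * d - 3) * p i + 8 \<le> 8 * (a i * p i)" if i: "i \<in> {1..r}" for i
  proof -
    have "(e + 1) * p i \<le> a i * p i"
      using assms(7)[OF i] e by (intro mult_right_mono) auto
    then show ?thesis using p0[OF i] by (simp add: e algebra_simps)
  qed
  then have "s_const (k * n) (cyclic_power n d) \<le> enat (9 * k * n)"
    using bound[of 8] by simp
  moreover have "s_const (k * n) (cyclic_power n d) \<le> enat (3 * k * n)"
    if large: "\<forall>i\<in>{1..r}. real (p i) \<ge> 4 * real d - 2 \<and> a i \<ge> p i + d"
  proof -
    have "(5 * d - 3) * p i + 2 \<le> 2 * (a i * p i)" if i: "i \<in> {1..r}" for i
    proof -
      have "real (p i) \<ge> 4 * real d - 2" "a i \<ge> p i + d" using large i by blast+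
      \<comment> \<open>The two hypotheses add up to \<open>a i \<ge> 5 * d - 2\<close>.\<close>
      then have "5 * e + 3 \<le> a i" using e by linarith
      then have "(5 * e + 3) * p i \<le> a i * p i" by (intro mult_right_mono) auto
      then show ?thesis using p0[OF i] by (simp add: e algebra_simps)
    qed
    then show ?thesis using bound[of 2] by simp
  qed
  ultimately show ?thesis by blast
qed

end
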